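(* Let $R$ be a commutative, associative, unital ring and let $N$ and $M$ be $R$-modules. Then the following hold: (1) $M$ is injective $\Rightarrow$ $M$ is $N$-injective $\Rightarrow$ $M$ is $\text{Red}$-$N$-injective $\Rightarrow$ $M$ is $\text{Soc}$-$N$-injective $\Rightarrow$ $M$ is min-$N$-injective. (2) $M$ is injective $\Rightarrow$ $M$ is strongly $\text{Red}$-injective $\Rightarrow$ $M$ is strongly $\text{Soc}$-injective $\Rightarrow$ $M$ is strongly min-injective $\Leftrightarrow$ $M$ is strongly simple-injective.
   Context: All modules are unital right $R$-modules. An $R$-module $M$ is reduced if for all $r\in R$ and $m\in M$, $mr^{2}=0$ implies $mr=0$; a submodule is reduced if it is reduced as a module. $\text{Red}(M)$ denotes the sum of all reduced submodules of $M$. A module $M$ is semi-reduced if $\text{Red}(M)=M$; a submodule is semi-reduced if it is so as a module. $\text{Soc}(N)$ is the sum of the simple submodules of $N$. For $R$-modules $M$ and $N$: - $M$ is $N$-injective if every $R$-homomorphism from a submodule of $N$ into $M$ extends to an $R$-homomorphism $N\rightarrow M$. - $M$ is $\text{Red}$-$N$-injective if for every semi-reduced submodule $K$ of $N$, every $R$-homomorphism $K\rightarrow M$ extends to $N$; $M$ is strongly $\text{Red}$-injective if it is $\text{Red}$-$N$-injective for all $R$-modules $N$. - $M$ is $\text{Soc}$-$N$-injective if every $R$-homomorphism $\text{Soc}(N)\rightarrow M$ extends to $N$; $M$ is strongly $\text{Soc}$-injective if it is $\text{Soc}$-$N$-injective for all $R$-modules $N$. - $M$ is min-$N$-injective if for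 every simple submodule $L$ of $N$, every homomorphism $L\rightarrow M$ extends to $N$; $M$ is strongly min-injective if it is min-$N$-injective for all $R$-modules $N$. - $M$ is simple-$N$-injective if for every submodule $L$ of $N$, every homomorphism $\theta:L\rightarrow M$ with $\theta(L)$ simple extends to a homomorphism $N\rightarrow M$; $M$ is strongly simple-injective if it is simple-$N$-injective for all $R$-modules $N$. *)

theory Defs
  imports "HOL-Algebra.Module"
begin

text \<open>
  Since the ring is commutative, a right module is the same thing as a module in the sense of
  \<^locale>\<open>module\<close>, and \<open>mr\<close> is written \<open>r \<odot> m\<close>. A submodule \<open>K\<close> of \<open>N\<close> is a subset of its carrier;
  regarded as a module it is \<open>N\<lparr>carrier := K\<rparr>\<close>.
\<close>

definition mod_hom ::
    "('r, 'x) ring_scheme \<Rightarrow> ('r, 'a, 'p) module_scheme \<Rightarrow> ('r, 'b, 'q) module_scheme \<Rightarrow> ('a \<Rightarrow> 'b) set"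
  where "mod_hom R A B =
    {h \<in> carrier A \<rightarrow> carrier B.
       (\<forall>x\<in>carrier A. \<forall>y\<in>carrier A. h (x \<oplus>\<^bsub>A\<^esub> y) = h x \<oplus>\<^bsub>B\<^esub> h y) \<and>
       (\<forall>r\<in>carrier R. \<forall>x\<in>carrier A. h (r \<odot>\<^bsub>A\<^esub> x) = r \<odot>\<^bsub>B\<^esub> h x)}"

definition reduced_module :: "('r, 'x) ring_scheme \<Rightarrow> ('r, 'a, 'p) module_scheme \<Rightarrow> bool"
  where "reduced_module R M \<longleftrightarrow>
    (\<forall>r\<in>carrier R. \<forall>m\<in>carrier M.
       (r [^]\<^bsub>R\<^esub> (2::nat)) \<odot>\<^bsub>M\<^esub> m = \<zero>\<^bsub>M\<^esub> \<longrightarrow> r \<odot>\<^bsub>M\<^esub> m = \<zero>\<^bsub>M\<^esub>)"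

definition simple_module :: "('r, 'x) ring_scheme \<Rightarrow> ('r, 'a, 'p) module_scheme \<Rightarrow> bool"
  where "simple_module R M \<longleftrightarrow>
    carrier M \<noteq> {\<zero>\<^bsub>M\<^esub>} \<and> (\<forall>H. submodule H R M \<longrightarrow> H = {\<zero>\<^bsub>M\<^esub>} \<or> H = carrier M)"

text \<open>The sum of a possibly infinite, possibly empty family of submodules: all finite sums of
  elements taken from members of the family.\<close>

definition submodule_sum :: "('r, 'a, 'p) module_scheme \<Rightarrow> 'a set set \<Rightarrow> 'a set"
  where "submodule_sum M \<K> =
    {finsum M f F | f F. finite F \<and> F \<subseteq> \<K> \<and> (\<forall>K\<in>F. f K \<in> K)}"

definition Red :: "('r, 'x) ring_scheme \<Rightarrow> ('r, 'a, 'p) module_scheme \<Rightarrow> 'a set"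
  where "Red R M =
    submodule_sum M {K. submodule K R M \<and> reduced_module R (M\<lparr>carrier := K\<rparr>)}"

definition Soc :: "('r, 'x) ring_scheme \<Rightarrow> ('r, 'a, 'p) module_scheme \<Rightarrow> 'a set"
  where "Soc R M =
    submodule_sum M {K. submodule K R M \<and> simple_module R (M\<lparr>carrier := K\<rparr>)}"

definition semi_reduced_module :: "('r, 'x) ring_scheme \<Rightarrow> ('r, 'a, 'p) module_scheme \<Rightarrow> bool"
  where "semi_reduced_module R M \<longleftrightarrow> Red R M = carrier M"

definition homs_extend ::
    "('r, 'x) ring_scheme \<Rightarrow> 'n set \<Rightarrow> ('r, 'n, 'p) module_scheme \<Rightarrow> ('r, 'm, 'q) module_scheme \<Rightarrow> bool"
  where "homs_extend R K N M \<longleftrightarrow>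
    (\<forall>f\<in>mod_hom R (N\<lparr>carrier := K\<rparr>) M. \<exists>g\<in>mod_hom R N M. \<forall>x\<in>K. g x = f x)"

text \<open>In the following relative notions the argument \<open>N\<close> precedes \<open>M\<close>:
  \<open>rel_injective R N M\<close> says that \<open>M\<close> is \<open>N\<close>-injective, and similarly for the others.\<close>

definition rel_injective ::
    "('r, 'x) ring_scheme \<Rightarrow> ('r, 'n, 'p) module_scheme \<Rightarrow> ('r, 'm, 'q) module_scheme \<Rightarrow> bool"
  where "rel_injective R N M \<longleftrightarrow> (\<forall>K. submodule K R N \<longrightarrow> homs_extend R K N M)"

definition Red_rel_injective ::
    "('r, 'x) ring_scheme \<Rightarrow> ('r, 'n, 'p) module_scheme \<Rightarrow> ('r, 'm, 'q) module_scheme \<Rightarrow> bool"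
  where "Red_rel_injective R N M \<longleftrightarrow>
    (\<forall>K. submodule K R N \<and> semi_reduced_module R (N\<lparr>carrier := K\<rparr>) \<longrightarrow> homs_extend R K N M)"

definition Soc_rel_injective ::
    "('r, 'x) ring_scheme \<Rightarrow> ('r, 'n, 'p) module_scheme \<Rightarrow> ('r, 'm, 'q) module_scheme \<Rightarrow> bool"
  where "Soc_rel_injective R N M \<longleftrightarrow> homs_extend R (Soc R N) N M"

definition min_rel_injective ::
    "('r, 'x) ring_scheme \<Rightarrow> ('r, 'n, 'p) module_scheme \<Rightarrow> ('r, 'm, 'q) module_scheme \<Rightarrow> bool"
  where "min_rel_injective R N M \<longleftrightarrow>
    (\<forall>L. submodule L R N \<and> simple_module R (N\<lparr>carrier := L\<rparr>) \<longrightarrow> homs_extend R L N M)"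

definition simple_rel_injective ::
    "('r, 'x) ring_scheme \<Rightarrow> ('r, 'n, 'p) module_scheme \<Rightarrow> ('r, 'm, 'q) module_scheme \<Rightarrow> bool"
  where "simple_rel_injective R N M \<longleftrightarrow>
    (\<forall>L. submodule L R N \<longrightarrow>
      (\<forall>\<theta>\<in>mod_hom R (N\<lparr>carrier := L\<rparr>) M.
         simple_module R (M\<lparr>carrier := \<theta> ` L\<rparr>) \<longrightarrow>
         (\<exists>g\<in>mod_hom R N M. \<forall>x\<in>L. g x = \<theta> x)))"

text \<open>
  The absolute notions quantify over all modules. HOL cannot quantify over types inside a
  formula, so the type \<open>'n\<close> from which the carriers of the test modules are drawn is a parameter,
  playing the role of a universe. The notion in the usual sense is the conjunction over all \<open>'n\<close>;
  hence an implication between two of these notions at the same, arbitrary \<open>'n\<close> yields the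
  implication between the usual notions.
\<close>

definition injective_module ::
    "'n itself \<Rightarrow> ('r, 'x) ring_scheme \<Rightarrow> ('r, 'm, 'q) module_scheme \<Rightarrow> bool"
  where "injective_module _ R M \<longleftrightarrow>
    (\<forall>N :: ('r, 'n) module. module R N \<longrightarrow> rel_injective R N M)"

definition strongly_Red_injective ::
    "'n itself \<Rightarrow> ('r, 'x) ring_scheme \<Rightarrow> ('r, 'm, 'q) module_scheme \<Rightarrow> bool"
  where "strongly_Red_injective _ R M \<longleftrightarrow>
    (\<forall>N :: ('r, 'n) module. module R N \<longrightarrow> Red_rel_injective R N M)"

definition strongly_Soc_injective ::
    "'n itself \<Rightarrow> ('r, 'x) ring_scheme \<Rightarrow> ('r, 'm, 'q) module_scheme \<Rightarrow> bool"
  where "strongly_Soc_injective _ R M \<longleftrightarrow>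
    (\<forall>N :: ('r, 'n) module. module R N \<longrightarrow> Soc_rel_injective R N M)"

definition strongly_min_injective ::
    "'n itself \<Rightarrow> ('r, 'x) ring_scheme \<Rightarrow> ('r, 'm, 'q) module_scheme \<Rightarrow> bool"
  where "strongly_min_injective _ R M \<longleftrightarrow>
    (\<forall>N :: ('r, 'n) module. module R N \<longrightarrow> min_rel_injective R N M)"

definition strongly_simple_injective ::
    "'n itself \<Rightarrow> ('r, 'x) ring_scheme \<Rightarrow> ('r, 'm, 'q) module_scheme \<Rightarrow> bool"
  where "strongly_simple_injective _ R M \<longleftrightarrow>
    (\<forall>N :: ('r, 'n) module. module R N \<longrightarrow> simple_rel_injective R N M)"

end

theory Submission
  imports Defs
begin

text \<open>
  Simple modules over a commutative ring are reduced, so the socle is semi-reduced. Given a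
  homomorphism \<open>f\<close> on a simple submodule \<open>L\<close>, Zorn's lemma yields a submodule \<open>C\<close> maximal with
  \<open>L \<inter> C = 0\<close>; then \<open>L \<oplus> C\<close> contains the socle, and \<open>f\<close> extends by zero on \<open>C\<close>, hence to the socle.
  For the equivalence, a homomorphism \<open>\<theta>\<close> on \<open>L\<close> with simple image factors through \<open>L / ker \<theta>\<close>,
  which is a simple submodule of \<open>N / ker \<theta>\<close>.
\<close>

section \<open>Submodules and homomorphisms\<close>

context abelian_group
begin

lemma minus_self: "x \<in> carrier G \<Longrightarrow> x \<ominus> x = \<zero>"
  by (simp add: minus_eq r_neg)

lemma minus_add_cancel:
  assumes "x \<in> carrier G" "y \<in> carrier G"
  shows "x \<ominus> y \<oplus> y = x"
  using assms by (simp add: minus_eq a_assoc l_neg)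

lemma add_minus_cancel:
  assumes "x \<in> carrier G" "y \<in> carrier G"
  shows "x \<oplus> y \<ominus> y = x"
  using assms by (simp add: minus_eq a_assoc r_neg)

lemma minus_zero_right: "x \<in> carrier G \<Longrightarrow> x \<ominus> \<zero> = x"
  using add_minus_cancel[of x \<zero>] by simp

lemma minus_eq_zeroD:
  assumes "x \<in> carrier G" "y \<in> carrier G" "x \<ominus> y = \<zero>"
  shows "x = y"
  using minus_add_cancel[OF assms(1,2)] assms by simp

lemma add_minus_add:
  assumes "x \<in> carrier G" "y \<in> carrier G" "x' \<in> carrier G" "y' \<in> carrier G"
  shows "(x \<oplus> y) \<ominus> (x' \<oplus> y') = (x \<ominus> x') \<oplus> (y \<ominus> y')"
  using assms by (simp add: minus_eq minus_add a_ac)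

lemma minus_add_minus:
  assumes "x \<in> carrier G" "y \<in> carrier G" "z \<in> carrier G"
  shows "(x \<ominus> y) \<oplus> (y \<ominus> z) = x \<ominus> z"
proof -
  have "(x \<ominus> y) \<oplus> (y \<ominus> z) = (x \<ominus> y \<oplus> y) \<ominus> z"
    using assms by (simp add: minus_eq a_assoc)
  then show ?thesis using assms by (simp add: minus_add_cancel)
qed

end

section \<open>Submodules: an elementwise criterion, intersections and sums\<close>

lemma (in module) submodule_iff:
  "submodule H R M \<longleftrightarrow> H \<subseteq> carrier M \<and> \<zero>\<^bsub>M\<^esub> \<in> H \<and>
     (\<forall>x\<in>H. \<forall>y\<in>H. x \<oplus>\<^bsub>M\<^esub> y \<in> H) \<and> (\<forall>r\<in>carrier R. \<forall>x\<in>H. r \<odot>\<^bsub>M\<^esub> x \<in> H)"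
proof
  assume H: "submodule H R M"
  moreover have "\<zero>\<^bsub>M\<^esub> \<in> H"
    using subgroup.one_closed[OF submodule.axioms(1)[OF H]] by simp
  ultimately show "H \<subseteq> carrier M \<and> \<zero>\<^bsub>M\<^esub> \<in> H \<and>
     (\<forall>x\<in>H. \<forall>y\<in>H. x \<oplus>\<^bsub>M\<^esub> y \<in> H) \<and> (\<forall>r\<in>carrier R. \<forall>x\<in>H. r \<odot>\<^bsub>M\<^esub> x \<in> H)"
    using submoduleE(1,4,5)[OF H] by simp
next
  assume H: "H \<subseteq> carrier M \<and> \<zero>\<^bsub>M\<^esub> \<in> H \<and>
     (\<forall>x\<in>H. \<forall>y\<in>H. x \<oplus>\<^bsub>M\<^esub> y \<in> H) \<and> (\<forall>r\<in>carrier R. \<forall>x\<in>H. r \<odot>\<^bsub>M\<^esub> x \<in> H)"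
  show "submodule H R M"
  proof (rule submoduleI)
    fix a assume a: "a \<in> H"
    \<comment> \<open>Closure under negation needs no clause of its own, since negation is
      multiplication by the scalar -1.\<close>
    with H have "(\<ominus> \<one>) \<odot>\<^bsub>M\<^esub> a \<in> H" by blast
    moreover have "(\<ominus> \<one>) \<odot>\<^bsub>M\<^esub> a = \<ominus>\<^bsub>M\<^esub> a"
      using a H smult_l_minus[of \<one> a] by auto
    ultimately show "\<ominus>\<^bsub>M\<^esub> a \<in> H" by simp
  qed (use H in auto)
qed

text \<open>Replacing the carrier leaves the zero, the addition and the scalar action of
  \<open>M\<close> in place, so both sides test the same closure conditions on \<open>H\<close>.
  This lets statements about the lattice of submodules of \<open>K\<close> be moved to that of
  \<open>M\<close>.\<close>

lemma (in module) submodule_of_submodule_iff: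
  assumes "submodule K R M"
  shows "submodule H R (M\<lparr>carrier := K\<rparr>) \<longleftrightarrow> submodule H R M \<and> H \<subseteq> K"
proof -
  interpret K: module R "M\<lparr>carrier := K\<rparr>"
    using submodule.submodule_is_module[OF assms module_axioms] .
  show ?thesis
    unfolding K.submodule_iff submodule_iff
    using submoduleE(1)[OF assms] by auto
qed

lemma (in module) submodule_Int:
  assumes "submodule H R M" and "submodule K R M"
  shows "submodule (H \<inter> K) R M"
  using assms unfolding submodule_iff by blast

lemma (in module) submodule_add:
  assumes "submodule H R M" and "submodule K R M"
  shows "submodule {x \<oplus>\<^bsub>M\<^esub> y | x y. x \<in> H \<and> y \<in> K} R M"
  unfolding submodule_iff
proof (intro conjI ballI)
  note H = assms(1)[unfolded submodule_iff] and K = assms(2)[unfolded submodule_iff]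
  show "{x \<oplus>\<^bsub>M\<^esub> y | x y. x \<in> H \<and> y \<in> K} \<subseteq> carrier M"
    using H K by auto
  show "\<zero>\<^bsub>M\<^esub> \<in> {x \<oplus>\<^bsub>M\<^esub> y | x y. x \<in> H \<and> y \<in> K}"
    using H K by (auto intro!: exI[of _ "\<zero>\<^bsub>M\<^esub>"])
next
  note H = assms(1)[unfolded submodule_iff] and K = assms(2)[unfolded submodule_iff]
  fix u v
  assume "u \<in> {x \<oplus>\<^bsub>M\<^esub> y | x y. x \<in> H \<and> y \<in> K}" "v \<in> {x \<oplus>\<^bsub>M\<^esub> y | x y. x \<in> H \<and> y \<in> K}"
  then obtain a b c d where u: "u = a \<oplus>\<^bsub>M\<^esub> b" and v: "v = c \<oplus>\<^bsub>M\<^esub> d"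
    and in_sub: "a \<in> H" "b \<in> K" "c \<in> H" "d \<in> K" by blast
  then have carr: "a \<in> carrier M" "b \<in> carrier M" "c \<in> carrier M" "d \<in> carrier M"
    using H K by auto
  have "u \<oplus>\<^bsub>M\<^esub> v = (a \<oplus>\<^bsub>M\<^esub> c) \<oplus>\<^bsub>M\<^esub> (b \<oplus>\<^bsub>M\<^esub> d)"
    unfolding u v using carr by (simp add: M.a_ac)
  moreover have "a \<oplus>\<^bsub>M\<^esub> c \<in> H" "b \<oplus>\<^bsub>M\<^esub> d \<in> K" using in_sub H K by auto
  ultimately show "u \<oplus>\<^bsub>M\<^esub> v \<in> {x \<oplus>\<^bsub>M\<^esub> y | x y. x \<in> H \<and> y \<in> K}" by blast
next
  note H = assms(1)[unfolded submodule_iff] and K = assms(2)[unfolded submodule_iff]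
  fix r u
  assume r: "r \<in> carrier R" and "u \<in> {x \<oplus>\<^bsub>M\<^esub> y | x y. x \<in> H \<and> y \<in> K}"
  then obtain a b where u: "u = a \<oplus>\<^bsub>M\<^esub> b" and in_sub: "a \<in> H" "b \<in> K" by blast
  then have "a \<in> carrier M" "b \<in> carrier M" using H K by auto
  then have "r \<odot>\<^bsub>M\<^esub> u = r \<odot>\<^bsub>M\<^esub> a \<oplus>\<^bsub>M\<^esub> r \<odot>\<^bsub>M\<^esub> b"
    using u r smult_r_distr by simp
  moreover have "r \<odot>\<^bsub>M\<^esub> a \<in> H" "r \<odot>\<^bsub>M\<^esub> b \<in> K" using in_sub r H K by auto
  ultimately show "r \<odot>\<^bsub>M\<^esub> u \<in> {x \<oplus>\<^bsub>M\<^esub> y | x y. x \<in> H \<and> y \<in> K}" by blast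
qed

lemma (in module) submodule_minus:
  assumes "submodule H R M" and "x \<in> H" and "y \<in> H"
  shows "x \<ominus>\<^bsub>M\<^esub> y \<in> H"
  using assms submoduleE(3,5)[OF assms(1)] by (simp add: M.minus_eq)

section \<open>Homomorphisms: images, preimages and factorization\<close>

lemma mod_homD:
  assumes "h \<in> mod_hom R A B"
  shows "\<And>x. x \<in> carrier A \<Longrightarrow> h x \<in> carrier B"
    and "\<And>x y. x \<in> carrier A \<Longrightarrow> y \<in> carrier A \<Longrightarrow> h (x \<oplus>\<^bsub>A\<^esub> y) = h x \<oplus>\<^bsub>B\<^esub> h y"
    and "\<And>r x. r \<in> carrier R \<Longrightarrow> x \<in> carrier A \<Longrightarrow> h (r \<odot>\<^bsub>A\<^esub> x) = r \<odot>\<^bsub>B\<^esub> h x"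
  using assms by (auto simp: mod_hom_def)

lemma mod_hom_comp:
  assumes "p \<in> mod_hom R A B" and "q \<in> mod_hom R B C"
  shows "q \<circ> p \<in> mod_hom R A C"
  using assms by (auto simp: mod_hom_def Pi_iff)

text \<open>Serves two ends: cutting the domain down to a submodule, and cutting the codomain down
  to the image, which makes a map surjective as \<open>simple_image\<close> and
  \<open>factor\<close> demand.\<close>

lemma mod_hom_restrict:
  assumes "h \<in> mod_hom R A B" and "H \<subseteq> carrier A" and "h ` H \<subseteq> K"
  shows "h \<in> mod_hom R (A\<lparr>carrier := H\<rparr>) (B\<lparr>carrier := K\<rparr>)"
  using assms by (simp add: mod_hom_def Pi_iff image_subset_iff subset_iff)

locale module_homomorphism = A: module R A + B: module R B
  for R :: "('r, 'x) ring_scheme" and A :: "('r, 'a, 'p) module_scheme"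
    and B :: "('r, 'b, 'q) module_scheme" +
  fixes h :: "'a \<Rightarrow> 'b"
  assumes hom: "h \<in> mod_hom R A B"
begin

lemmas hom_closed = mod_homD(1)[OF hom]
  and hom_add = mod_homD(2)[OF hom]
  and hom_smult = mod_homD(3)[OF hom]

lemma hom_zero: "h \<zero>\<^bsub>A\<^esub> = \<zero>\<^bsub>B\<^esub>"
  using hom_smult[of "\<zero>\<^bsub>R\<^esub>" "\<zero>\<^bsub>A\<^esub>"] hom_closed[of "\<zero>\<^bsub>A\<^esub>"] by simp

lemma hom_minus:
  assumes "x \<in> carrier A" and "y \<in> carrier A"
  shows "h (x \<ominus>\<^bsub>A\<^esub> y) = h x \<ominus>\<^bsub>B\<^esub> h y"
proof -
  have "h (x \<ominus>\<^bsub>A\<^esub> y) \<oplus>\<^bsub>B\<^esub> h y = h x"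
    using assms hom_add[of "x \<ominus>\<^bsub>A\<^esub> y" y] by (simp add: A.minus_add_cancel)
  then show ?thesis
    using assms B.add_minus_cancel[of "h (x \<ominus>\<^bsub>A\<^esub> y)" "h y"] by (simp add: hom_closed)
qed

lemma image_submodule:
  assumes "submodule H R A"
  shows "submodule (h ` H) R B"
  unfolding B.submodule_iff
proof (intro conjI ballI)
  note H = assms[unfolded A.submodule_iff]
  have carr: "\<And>x. x \<in> H \<Longrightarrow> x \<in> carrier A" using H by blast
  show "h ` H \<subseteq> carrier B" using carr hom_closed by blast
  show "\<zero>\<^bsub>B\<^esub> \<in> h ` H" using H hom_zero by (metis imageI)
next
  note H = assms[unfolded A.submodule_iff]
  have carr: "\<And>x. x \<in> H \<Longrightarrow> x \<in> carrier A" using H by blast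
  fix u v assume "u \<in> h ` H" "v \<in> h ` H"
  then obtain x y where "x \<in> H" "y \<in> H" "u = h x" "v = h y" by blast
  then show "u \<oplus>\<^bsub>B\<^esub> v \<in> h ` H"
    using H by (intro image_eqI[of _ _ "x \<oplus>\<^bsub>A\<^esub> y"]) (simp_all add: hom_add carr)
next
  note H = assms[unfolded A.submodule_iff]
  have carr: "\<And>x. x \<in> H \<Longrightarrow> x \<in> carrier A" using H by blast
  fix r u assume "r \<in> carrier R" "u \<in> h ` H"
  then obtain x where "r \<in> carrier R" "x \<in> H" "u = h x" by blast
  then show "r \<odot>\<^bsub>B\<^esub> u \<in> h ` H"
    using H by (intro image_eqI[of _ _ "r \<odot>\<^bsub>A\<^esub> x"]) (simp_all add: hom_smult carr)
qed

lemma range_submodule: "submodule (h ` carrier A) R B"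
  by (rule image_submodule[OF A.carrier_is_submodule])

lemma vimage_submodule:
  assumes "submodule H R B"
  shows "submodule {x \<in> carrier A. h x \<in> H} R A"
  using assms[unfolded B.submodule_iff]
  by (simp add: A.submodule_iff hom_zero hom_add hom_smult subset_iff)

text \<open>By surjectivity a submodule \<open>H\<close> of \<open>B\<close> is the image of its own
  preimage, and simplicity of \<open>A\<close> leaves only zero or everything for that preimage. The
  assumption that \<open>B\<close> is nonzero excludes the zero quotient, the one image of a simple
  module that is not simple.\<close>

lemma simple_image:
  assumes surj: "h ` carrier A = carrier B" and "simple_module R A" and "carrier B \<noteq> {\<zero>\<^bsub>B\<^esub>}"
  shows "simple_module R B"
  unfolding simple_module_def
proof (intro conjI allI impI)
  show "carrier B \<noteq> {\<zero>\<^bsub>B\<^esub>}" by fact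
next
  fix H assume H: "submodule H R B"
  let ?P = "{x \<in> carrier A. h x \<in> H}"
  have "h ` ?P = h ` carrier A \<inter> H" by blast
  then have image: "h ` ?P = H"
    unfolding surj using B.submoduleE(1)[OF H] by (simp only: Int_absorb1)
  have "?P = {\<zero>\<^bsub>A\<^esub>} \<or> ?P = carrier A"
    using vimage_submodule[OF H] assms(2) by (simp add: simple_module_def)
  then show "H = {\<zero>\<^bsub>B\<^esub>} \<or> H = carrier B"
  proof
    assume P: "?P = {\<zero>\<^bsub>A\<^esub>}"
    show ?thesis using image hom_zero unfolding P by simp
  next
    assume P: "?P = carrier A"
    show ?thesis using image surj unfolding P by simp
  qed
qed

text \<open>If \<open>h x = h y\<close>, then \<open>x - y\<close> lies in the kernel of
  \<open>h\<close>, hence in that of \<open>q\<close>, so \<open>q\<close> is constant on the fibres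
  of \<open>h\<close> and descends along \<open>h\<close>.\<close>

lemma factor:
  assumes surj: "h ` carrier A = carrier B" and q: "module_homomorphism R A C q"
    and ker: "\<And>x. x \<in> carrier A \<Longrightarrow> h x = \<zero>\<^bsub>B\<^esub> \<Longrightarrow> q x = \<zero>\<^bsub>C\<^esub>"
  shows "\<exists>f\<in>mod_hom R B C. \<forall>x\<in>carrier A. f (h x) = q x"
proof -
  note q_closed = module_homomorphism.hom_closed[OF q]
  note C = module.axioms(2)[OF module_homomorphism.axioms(2)[OF q]]
  have eq: "q x = q y" if xy: "x \<in> carrier A" "y \<in> carrier A" and "h x = h y" for x y
  proof -
    have "h (x \<ominus>\<^bsub>A\<^esub> y) = \<zero>\<^bsub>B\<^esub>"
      unfolding hom_minus[OF xy] that(3) by (rule B.minus_self[OF hom_closed[OF xy(2)]])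
    then have "q (x \<ominus>\<^bsub>A\<^esub> y) = \<zero>\<^bsub>C\<^esub>" by (rule ker[OF A.minus_closed[OF xy]])
    then show ?thesis
      unfolding module_homomorphism.hom_minus[OF q xy]
      by (rule abelian_group.minus_eq_zeroD[OF C q_closed[OF xy(1)] q_closed[OF xy(2)]])
  qed
  \<comment> \<open>An arbitrary preimage under \<open>h\<close> is chosen; by \<open>eq\<close> the
    choice does not affect the value. Surjectivity of \<open>h\<close> ensures that every element of
    \<open>carrier B\<close> has a preimage.\<close>
  define f where "f = (\<lambda>z. q (SOME x. x \<in> carrier A \<and> h x = z))"
  have f: "f (h x) = q x" if x: "x \<in> carrier A" for x
  proof -
    have "\<exists>y. y \<in> carrier A \<and> h y = h x" using x by blast
    from someI_ex[OF this] show ?thesis unfolding f_def by (intro eq x) simp_all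
  qed
  have "f \<in> mod_hom R B C"
    unfolding mod_hom_def surj[symmetric]
  proof (intro CollectI conjI ballI)
    show "f \<in> h ` carrier A \<rightarrow> carrier C" by (auto simp: f q_closed)
  next
    fix u v assume "u \<in> h ` carrier A" "v \<in> h ` carrier A"
    then obtain x y where xy: "x \<in> carrier A" "y \<in> carrier A" "u = h x" "v = h y" by blast
    then have "u \<oplus>\<^bsub>B\<^esub> v = h (x \<oplus>\<^bsub>A\<^esub> y)" by (simp add: hom_add)
    then show "f (u \<oplus>\<^bsub>B\<^esub> v) = f u \<oplus>\<^bsub>C\<^esub> f v"
      using xy by (simp add: f module_homomorphism.hom_add[OF q])
  next
    fix r u assume r: "r \<in> carrier R" and "u \<in> h ` carrier A"
    then obtain x where x: "x \<in> carrier A" "u = h x" by blast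
    then have "r \<odot>\<^bsub>B\<^esub> u = h (r \<odot>\<^bsub>A\<^esub> x)" using r by (simp add: hom_smult)
    then show "f (r \<odot>\<^bsub>B\<^esub> u) = r \<odot>\<^bsub>C\<^esub> f u"
      using x r by (simp add: f module_homomorphism.hom_smult[OF q])
  qed
  with f show ?thesis by blast
qed

end

lemma module_homomorphismI:
  "module R A \<Longrightarrow> module R B \<Longrightarrow> h \<in> mod_hom R A B \<Longrightarrow> module_homomorphism R A B h"
  by (simp add: module_homomorphism_def module_homomorphism_axioms_def)

text \<open>
  The quotient \<open>M / K\<close> is realised on a set of coset representatives, so that its carrier has the
  same type as that of \<open>M\<close>. The multiplicative fields of the record are irrelevant.
\<close>

lemma (in module) quotient_module_exists:
  assumes K: "submodule K R M"
  shows "\<exists>(Q :: ('a, 'c) module) p. module R Q \<and> p \<in> mod_hom R M Q \<and>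
    p ` carrier M = carrier Q \<and> (\<forall>x\<in>carrier M. p x = \<zero>\<^bsub>Q\<^esub> \<longleftrightarrow> x \<in> K)"
proof -
  note Kc = K[unfolded submodule_iff]
  \<comment> \<open>\<open>rel x\<close> is the predicate of belonging to the coset of
    \<open>x\<close>. Since \<open>rep x\<close> depends on \<open>x\<close> only through this
    predicate, elements of one coset receive literally the same representative, and equality of
    cosets becomes equality of elements.\<close>
  define rel where "rel x y \<longleftrightarrow> y \<in> carrier M \<and> y \<ominus>\<^bsub>M\<^esub> x \<in> K" for x y
  define rep where "rep x = (SOME y. rel x y)" for x
  have rep: "rep x \<in> carrier M" "rep x \<ominus>\<^bsub>M\<^esub> x \<in> K" if "x \<in> carrier M" for x
  proof -
    have "rel x x" using that Kc by (simp add: rel_def M.minus_self)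
    then have "rel x (rep x)" unfolding rep_def by (rule someI)
    then show "rep x \<in> carrier M" "rep x \<ominus>\<^bsub>M\<^esub> x \<in> K" by (simp_all add: rel_def)
  qed
  have rep_eq: "rep x = rep y"
    if "x \<in> carrier M" "y \<in> carrier M" "x \<ominus>\<^bsub>M\<^esub> y \<in> K" for x y
  proof -
    have "rel x z \<longleftrightarrow> rel y z" for z
    proof (cases "z \<in> carrier M")
      case z: True
      \<comment> \<open>The differences \<open>z - x\<close> and \<open>z - y\<close> differ by the
        element \<open>x - y\<close> of \<open>K\<close>, so one lies in \<open>K\<close> exactly
        when the other does.\<close>
      have "z \<ominus>\<^bsub>M\<^esub> y = (z \<ominus>\<^bsub>M\<^esub> x) \<oplus>\<^bsub>M\<^esub> (x \<ominus>\<^bsub>M\<^esub> y)"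
        using that z by (simp add: M.minus_add_minus)
      moreover from this have "(z \<ominus>\<^bsub>M\<^esub> y) \<ominus>\<^bsub>M\<^esub> (x \<ominus>\<^bsub>M\<^esub> y) = z \<ominus>\<^bsub>M\<^esub> x"
        using that z by (simp add: M.add_minus_cancel)
      ultimately show ?thesis
        using z that(3) Kc submodule_minus[OF K] unfolding rel_def by metis
    qed (simp add: rel_def)
    then have "rel x = rel y" by blast
    then show ?thesis unfolding rep_def by simp
  qed
  have rep_rep: "rep (rep x) = rep x" if "x \<in> carrier M" for x
    using rep_eq rep that by simp
  have rep_add: "rep (rep x \<oplus>\<^bsub>M\<^esub> rep y) = rep (x \<oplus>\<^bsub>M\<^esub> y)"
    if "x \<in> carrier M" "y \<in> carrier M" for x y
  proof (rule rep_eq)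
    have "(rep x \<oplus>\<^bsub>M\<^esub> rep y) \<ominus>\<^bsub>M\<^esub> (x \<oplus>\<^bsub>M\<^esub> y) = (rep x \<ominus>\<^bsub>M\<^esub> x) \<oplus>\<^bsub>M\<^esub> (rep y \<ominus>\<^bsub>M\<^esub> y)"
      using that rep by (simp add: M.add_minus_add)
    then show "(rep x \<oplus>\<^bsub>M\<^esub> rep y) \<ominus>\<^bsub>M\<^esub> (x \<oplus>\<^bsub>M\<^esub> y) \<in> K"
      using rep that Kc by simp
  qed (use that rep in auto)
  have rep_smult: "rep (r \<odot>\<^bsub>M\<^esub> rep x) = rep (r \<odot>\<^bsub>M\<^esub> x)"
    if "r \<in> carrier R" "x \<in> carrier M" for r x
  proof (rule rep_eq)
    have "r \<odot>\<^bsub>M\<^esub> rep x \<ominus>\<^bsub>M\<^esub> r \<odot>\<^bsub>M\<^esub> x = r \<odot>\<^bsub>M\<^esub> (rep x \<ominus>\<^bsub>M\<^esub> x)"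
      using that rep by (simp add: M.minus_eq smult_r_distr smult_r_minus)
    then show "r \<odot>\<^bsub>M\<^esub> rep x \<ominus>\<^bsub>M\<^esub> r \<odot>\<^bsub>M\<^esub> x \<in> K"
      using rep that Kc by simp
  qed (use that rep in auto)
  define Q :: "('a, 'c) module" where
    "Q = \<lparr>carrier = rep ` carrier M, mult = undefined, one = undefined, zero = rep \<zero>\<^bsub>M\<^esub>,
          add = (\<lambda>x y. rep (x \<oplus>\<^bsub>M\<^esub> y)), smult = (\<lambda>r x. rep (r \<odot>\<^bsub>M\<^esub> x))\<rparr>"
  have Q: "carrier Q = rep ` carrier M" "\<zero>\<^bsub>Q\<^esub> = rep \<zero>\<^bsub>M\<^esub>"
    "\<And>x y. x \<oplus>\<^bsub>Q\<^esub> y = rep (x \<oplus>\<^bsub>M\<^esub> y)" "\<And>r x. r \<odot>\<^bsub>Q\<^esub> x = rep (r \<odot>\<^bsub>M\<^esub> x)"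
    by (simp_all add: Q_def)
  have "module R Q"
  proof (rule moduleI)
    show "cring R" by (rule is_cring)
    show "abelian_group Q"
    proof (rule abelian_groupI)
      fix u assume "u \<in> carrier Q"
      then obtain x where x: "x \<in> carrier M" "u = rep x" using Q by auto
      then have "rep (\<ominus>\<^bsub>M\<^esub> x) \<oplus>\<^bsub>Q\<^esub> u = \<zero>\<^bsub>Q\<^esub>" by (simp add: Q rep_add M.l_neg)
      then show "\<exists>v\<in>carrier Q. v \<oplus>\<^bsub>Q\<^esub> u = \<zero>\<^bsub>Q\<^esub>" using x Q by auto
    qed (auto simp: Q rep_add rep M.a_ac)
  next
    fix a b u assume "a \<in> carrier R" "b \<in> carrier R" "u \<in> carrier Q"
    then obtain x where ab: "a \<in> carrier R" "b \<in> carrier R" and x: "x \<in> carrier M" "u = rep x"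
      using Q by auto
    show "(a \<oplus>\<^bsub>R\<^esub> b) \<odot>\<^bsub>Q\<^esub> u = a \<odot>\<^bsub>Q\<^esub> u \<oplus>\<^bsub>Q\<^esub> b \<odot>\<^bsub>Q\<^esub> u"
      unfolding Q x(2) using ab x(1) by (simp only: rep_smult rep_add smult_closed
          R.add.m_closed smult_l_distr)
    show "(a \<otimes>\<^bsub>R\<^esub> b) \<odot>\<^bsub>Q\<^esub> u = a \<odot>\<^bsub>Q\<^esub> (b \<odot>\<^bsub>Q\<^esub> u)"
      unfolding Q x(2) using ab x(1) by (simp only: rep_smult smult_closed
          R.m_closed smult_assoc1)
  qed (auto simp: Q rep_add rep rep_smult rep_rep smult_r_distr)
  moreover have "rep \<in> mod_hom R M Q"
    by (auto simp: mod_hom_def Q rep_add rep_smult)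
  moreover have "rep x = \<zero>\<^bsub>Q\<^esub> \<longleftrightarrow> x \<in> K" if x: "x \<in> carrier M" for x
  proof
    assume "x \<in> K"
    then show "rep x = \<zero>\<^bsub>Q\<^esub>" unfolding Q using x by (intro rep_eq) (simp_all add: M.minus_zero_right)
  next
    assume "rep x = \<zero>\<^bsub>Q\<^esub>"
    \<comment> \<open>Now \<open>rep x\<close> represents the coset \<open>K\<close> and so lies in
      \<open>K\<close>. The difference \<open>rep x - x\<close> lies there too, and \<open>x\<close>
      is recovered as \<open>rep x - (rep x - x)\<close>.\<close>
    then have "rep x \<in> K" using rep(2)[of "\<zero>\<^bsub>M\<^esub>"] rep(1)[of "\<zero>\<^bsub>M\<^esub>"] by (simp add: Q M.minus_zero_right)
    then have "rep x \<ominus>\<^bsub>M\<^esub> (rep x \<ominus>\<^bsub>M\<^esub> x) \<in> K"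
      using submodule_minus[OF K] rep(2)[OF x] by blast
    moreover have "rep x \<ominus>\<^bsub>M\<^esub> (rep x \<ominus>\<^bsub>M\<^esub> x) = x"
    proof -
      have "rep x = rep x \<ominus>\<^bsub>M\<^esub> x \<oplus>\<^bsub>M\<^esub> x" using x rep by (simp add: M.minus_add_cancel)
      then show ?thesis
        using x rep M.add_minus_cancel[of x "rep x \<ominus>\<^bsub>M\<^esub> x"] by (simp add: M.a_comm)
    qed
    ultimately show "x \<in> K" by simp
  qed
  ultimately show ?thesis using Q(1) by blast
qed

section \<open>Sums of submodules and the socle\<close>

context module
begin

lemma submodule_finsum_closed:
  assumes "submodule H R M" and "finite F" and "\<And>i. i \<in> F \<Longrightarrow> f i \<in> H"
  shows "finsum M f F \<in> H"
  using assms(2,3)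
proof (induction F rule: finite_induct)
  case empty
  then show ?case using assms(1) by (simp add: submodule_iff)
next
  case (insert i F)
  moreover have "f \<in> insert i F \<rightarrow> carrier M"
    using insert.prems assms(1) by (auto simp: submodule_iff)
  ultimately show ?case using assms(1) by (simp add: submodule_iff Pi_iff)
qed

lemma submodule_sum_least:
  assumes "submodule H R M" and "\<And>K. K \<in> \<K> \<Longrightarrow> K \<subseteq> H"
  shows "submodule_sum M \<K> \<subseteq> H"
  unfolding submodule_sum_def using assms by (blast intro: submodule_finsum_closed)

lemma submodule_sum_upper:
  assumes "\<And>K. K \<in> \<K> \<Longrightarrow> submodule K R M" and "K \<in> \<K>"
  shows "K \<subseteq> submodule_sum M \<K>"
proof
  fix x assume x: "x \<in> K"
  with assms have "x \<in> carrier M" using submoduleE(1) by blast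
  then have "finsum M (\<lambda>_. x) {K} = x" by simp
  then show "x \<in> submodule_sum M \<K>"
    unfolding submodule_sum_def using x assms(2)
    by (intro CollectI exI[of _ "\<lambda>_. x"] exI[of _ "{K}"]) simp
qed

lemma submodule_sum_submodule:
  assumes sub: "\<And>K. K \<in> \<K> \<Longrightarrow> submodule K R M"
  shows "submodule (submodule_sum M \<K>) R M"
  unfolding submodule_iff
proof (intro conjI ballI)
  show "submodule_sum M \<K> \<subseteq> carrier M"
    using submodule_sum_least[OF carrier_is_submodule] sub submoduleE(1) by blast
  show "\<zero>\<^bsub>M\<^esub> \<in> submodule_sum M \<K>"
    \<comment> \<open>Zero is the empty sum, which is available even for an empty family.\<close>
    unfolding submodule_sum_def by (force intro!: exI[of _ "{}"])
next
  have sub': "K \<subseteq> carrier M" "\<zero>\<^bsub>M\<^esub> \<in> K" "\<forall>x\<in>K. \<forall>y\<in>K. x \<oplus>\<^bsub>M\<^esub> y \<in> K"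
    if "K \<in> \<K>" for K using sub[OF that] by (simp_all add: submodule_iff)
  fix u v assume "u \<in> submodule_sum M \<K>" "v \<in> submodule_sum M \<K>"
  then obtain f F g G
    where u: "u = finsum M f F" "finite F" "F \<subseteq> \<K>" "\<forall>K\<in>F. f K \<in> K"
      and v: "v = finsum M g G" "finite G" "G \<subseteq> \<K>" "\<forall>K\<in>G. g K \<in> K"
    unfolding submodule_sum_def by blast
  \<comment> \<open>The two sums run over different finite subfamilies \<open>F\<close> and
    \<open>G\<close>. Padding both selections with zeros carries them to the common index set
    \<open>F \<union> G\<close>, where they can be added member by member.\<close>
  define f' where "f' K = (if K \<in> F then f K else \<zero>\<^bsub>M\<^esub>)" for K
  define g' where "g' K = (if K \<in> G then g K else \<zero>\<^bsub>M\<^esub>)" for K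
  have f': "f' K \<in> K" and g': "g' K \<in> K" if "K \<in> \<K>" for K
    using that u(4) v(4) sub'(2) by (simp_all add: f'_def g'_def)
  have carr: "f' \<in> F \<union> G \<rightarrow> carrier M" "g' \<in> F \<union> G \<rightarrow> carrier M"
    using f' g' u(3) v(3) sub'(1) by blast+
  have "finsum M f F = finsum M f' (F \<union> G)"
    using u(2) v(2) carr(1)
    by (intro M.add.finprod_mono_neutral_cong_left) (simp_all add: f'_def)
  moreover have "finsum M g G = finsum M g' (F \<union> G)"
    using u(2) v(2) carr(2)
    by (intro M.add.finprod_mono_neutral_cong_left) (simp_all add: g'_def)
  ultimately have "u \<oplus>\<^bsub>M\<^esub> v = finsum M (\<lambda>K. f' K \<oplus>\<^bsub>M\<^esub> g' K) (F \<union> G)"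
    using u(1) v(1) M.finsum_addf[OF carr] by (simp only:)
  moreover have "\<forall>K\<in>F \<union> G. f' K \<oplus>\<^bsub>M\<^esub> g' K \<in> K" using f' g' sub'(3) u(3) v(3) by blast
  ultimately show "u \<oplus>\<^bsub>M\<^esub> v \<in> submodule_sum M \<K>"
    unfolding submodule_sum_def using u(2,3) v(2,3)
    by (intro CollectI exI[of _ "\<lambda>K. f' K \<oplus>\<^bsub>M\<^esub> g' K"] exI[of _ "F \<union> G"]) simp
next
  fix r u assume r: "r \<in> carrier R" and "u \<in> submodule_sum M \<K>"
  then obtain f F where u: "u = finsum M f F" "finite F" "F \<subseteq> \<K>" "\<forall>K\<in>F. f K \<in> K"
    unfolding submodule_sum_def by blast
  have "f \<in> F \<rightarrow> carrier M" using u sub submoduleE(1) by blast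
  then have "r \<odot>\<^bsub>M\<^esub> u = finsum M (\<lambda>K. r \<odot>\<^bsub>M\<^esub> f K) F"
    using u r finsum_smult_ldistr by simp
  moreover have "\<forall>K\<in>F. r \<odot>\<^bsub>M\<^esub> f K \<in> K" using u r sub submoduleE(4) by blast
  ultimately show "r \<odot>\<^bsub>M\<^esub> u \<in> submodule_sum M \<K>"
    unfolding submodule_sum_def using u
    by (intro CollectI exI[of _ "\<lambda>K. r \<odot>\<^bsub>M\<^esub> f K"] exI[of _ F]) simp
qed

section \<open>The socle, its universal property and its semi-reducedness\<close>

lemma Soc_submodule: "submodule (Soc R M) R M"
  unfolding Soc_def by (rule submodule_sum_submodule) simp

lemma simple_subset_Soc:
  assumes "submodule L R M" and "simple_module R (M\<lparr>carrier := L\<rparr>)"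
  shows "L \<subseteq> Soc R M"
  unfolding Soc_def by (rule submodule_sum_upper) (use assms in auto)

lemma Soc_least:
  assumes "submodule H R M"
    and "\<And>L. submodule L R M \<Longrightarrow> simple_module R (M\<lparr>carrier := L\<rparr>) \<Longrightarrow> L \<subseteq> H"
  shows "Soc R M \<subseteq> H"
  unfolding Soc_def by (rule submodule_sum_least) (use assms in auto)

text \<open>If \<open>rm\<close> were nonzero, the cyclic submodule that it generates would be all
  of the module, so \<open>m = s(rm)\<close> for some scalar \<open>s\<close>. Commutativity of the
  ring then gives \<open>rm = (rsr)m = s(r^2 m) = 0\<close>, a contradiction.\<close>

lemma simple_imp_reduced:
  assumes "simple_module R M"
  shows "reduced_module R M"
  unfolding reduced_module_def
proof (intro ballI impI, rule ccontr)
  fix r m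
  assume r: "r \<in> carrier R" and m: "m \<in> carrier M"
    and sq: "(r [^] (2::nat)) \<odot>\<^bsub>M\<^esub> m = \<zero>\<^bsub>M\<^esub>" and nz: "r \<odot>\<^bsub>M\<^esub> m \<noteq> \<zero>\<^bsub>M\<^esub>"
  let ?H = "(\<lambda>s. s \<odot>\<^bsub>M\<^esub> (r \<odot>\<^bsub>M\<^esub> m)) ` carrier R"
  have rm: "r \<odot>\<^bsub>M\<^esub> m \<in> carrier M" using r m by simp
  have "submodule ?H R M"
    unfolding submodule_iff
  proof (intro conjI ballI)
    show "?H \<subseteq> carrier M" using rm by auto
    show "\<zero>\<^bsub>M\<^esub> \<in> ?H" using rm by (intro image_eqI[of _ _ \<zero>]) simp_all
  next
    fix u v assume "u \<in> ?H" "v \<in> ?H"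
    then obtain s t where st: "s \<in> carrier R" "t \<in> carrier R"
      "u = s \<odot>\<^bsub>M\<^esub> (r \<odot>\<^bsub>M\<^esub> m)" "v = t \<odot>\<^bsub>M\<^esub> (r \<odot>\<^bsub>M\<^esub> m)" by blast
    then show "u \<oplus>\<^bsub>M\<^esub> v \<in> ?H" using rm
      by (intro image_eqI[of _ _ "s \<oplus> t"]) (simp_all add: smult_l_distr)
  next
    fix a u assume a: "a \<in> carrier R" and "u \<in> ?H"
    then obtain s where s: "s \<in> carrier R" "u = s \<odot>\<^bsub>M\<^esub> (r \<odot>\<^bsub>M\<^esub> m)" by blast
    then show "a \<odot>\<^bsub>M\<^esub> u \<in> ?H" using a rm
      by (intro image_eqI[of _ _ "a \<otimes> s"]) (simp_all add: smult_assoc1)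
  qed
  moreover have "r \<odot>\<^bsub>M\<^esub> m \<in> ?H" using rm by (intro image_eqI[of _ _ \<one>]) simp_all
  ultimately have "?H = carrier M" using assms nz unfolding simple_module_def by blast
  with m obtain s where s: "s \<in> carrier R" "m = s \<odot>\<^bsub>M\<^esub> (r \<odot>\<^bsub>M\<^esub> m)" by blast
  have "r \<odot>\<^bsub>M\<^esub> m = r \<odot>\<^bsub>M\<^esub> (s \<odot>\<^bsub>M\<^esub> (r \<odot>\<^bsub>M\<^esub> m))" using s by simp
  also have "\<dots> = (r \<otimes> s \<otimes> r) \<odot>\<^bsub>M\<^esub> m" using r s m by (simp add: smult_assoc1)
  also have "r \<otimes> s \<otimes> r = s \<otimes> (r [^] (2::nat))"
    using r s by (simp add: numeral_2_eq_2 m_ac)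
  also have "\<dots> \<odot>\<^bsub>M\<^esub> m = \<zero>\<^bsub>M\<^esub>" using r s(1) m sq by (simp add: smult_assoc1)
  finally show False using nz by simp
qed

lemma Soc_semi_reduced: "semi_reduced_module R (M\<lparr>carrier := Soc R M\<rparr>)"
proof -
  let ?S = "M\<lparr>carrier := Soc R M\<rparr>"
  let ?\<K> = "{K. submodule K R ?S \<and> reduced_module R (?S\<lparr>carrier := K\<rparr>)}"
  interpret S: module R ?S
    using submodule.submodule_is_module[OF Soc_submodule module_axioms] .
  have Red: "submodule (Red R ?S) R ?S"
    unfolding Red_def by (rule S.submodule_sum_submodule) simp
  have "L \<subseteq> Red R ?S" if L: "submodule L R M" and simple: "simple_module R (M\<lparr>carrier := L\<rparr>)" for L
  proof -
    have "reduced_module R (M\<lparr>carrier := L\<rparr>)"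
      using module.simple_imp_reduced[OF submodule.submodule_is_module[OF L module_axioms] simple] .
    \<comment> \<open>The second carrier update overrides the first, so \<open>L\<close> regarded
      inside the socle is the same module as \<open>L\<close> regarded inside \<open>M\<close>, and
      reducedness carries over unchanged.\<close>
    then have "L \<in> ?\<K>"
      using L simple_subset_Soc[OF L simple] submodule_of_submodule_iff[OF Soc_submodule] by simp
    then show ?thesis unfolding Red_def by (intro S.submodule_sum_upper) auto
  qed
  \<comment> \<open>Viewed as a submodule of \<open>M\<close>, \<open>Red R ?S\<close> contains
    every simple submodule of \<open>M\<close>, so minimality of the socle yields the missing
    inclusion.\<close>
  moreover have "submodule (Red R ?S) R M" "Red R ?S \<subseteq> Soc R M"
    using Red submodule_of_submodule_iff[OF Soc_submodule] by blast+
  ultimately have "Red R ?S = Soc R M" using Soc_least by blast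
  then show ?thesis by (simp add: semi_reduced_module_def)
qed

section \<open>Complements of a submodule and extension by zero\<close>

lemma maximal_disjoint_submodule:
  assumes L: "submodule L R M"
  shows "\<exists>C. submodule C R M \<and> C \<inter> L = {\<zero>\<^bsub>M\<^esub>} \<and>
    (\<forall>D. submodule D R M \<and> D \<inter> L = {\<zero>\<^bsub>M\<^esub>} \<and> C \<subseteq> D \<longrightarrow> D = C)"
proof -
  let ?A = "{C. submodule C R M \<and> C \<inter> L = {\<zero>\<^bsub>M\<^esub>}}"
  have "\<exists>C\<in>?A. \<forall>D\<in>?A. C \<subseteq> D \<longrightarrow> D = C"
  proof (rule subset_Zorn_nonempty)
    have "{\<zero>\<^bsub>M\<^esub>} \<in> ?A" using L by (auto simp: submodule_iff)
    then show "?A \<noteq> {}" by blast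
  next
    fix \<C> assume ne: "\<C> \<noteq> {}" and chain: "subset.chain ?A \<C>"
    have sub: "\<And>C. C \<in> \<C> \<Longrightarrow> submodule C R M \<and> C \<inter> L = {\<zero>\<^bsub>M\<^esub>}"
      and lin: "\<And>C D. C \<in> \<C> \<Longrightarrow> D \<in> \<C> \<Longrightarrow> C \<subseteq> D \<or> D \<subseteq> C"
      using chain unfolding subset.chain_def by auto
    have "submodule (\<Union>\<C>) R M"
      unfolding submodule_iff
    proof (intro conjI ballI)
      show "\<Union>\<C> \<subseteq> carrier M" "\<zero>\<^bsub>M\<^esub> \<in> \<Union>\<C>" using sub[unfolded submodule_iff] ne by blast+
    next
      fix x y assume "x \<in> \<Union>\<C>" "y \<in> \<Union>\<C>"
      \<comment> \<open>Of the two chain members containing \<open>x\<close> and \<open>y\<close>,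
        the larger contains both.\<close>
      then obtain C where "C \<in> \<C>" "x \<in> C" "y \<in> C" using lin by blast
      then show "x \<oplus>\<^bsub>M\<^esub> y \<in> \<Union>\<C>" using sub submoduleE(5) by blast
    next
      fix r x assume "r \<in> carrier R" "x \<in> \<Union>\<C>"
      then show "r \<odot>\<^bsub>M\<^esub> x \<in> \<Union>\<C>" using sub submoduleE(4) by blast
    qed
    moreover have "\<Union>\<C> \<inter> L = {\<zero>\<^bsub>M\<^esub>}" using sub ne by blast
    ultimately show "\<Union>\<C> \<in> ?A" by simp
  qed
  then obtain C where "C \<in> ?A" "\<forall>D\<in>?A. C \<subseteq> D \<longrightarrow> D = C" by (rule bexE)
  then show ?thesis by (intro exI[of _ C]) simp
qed

text \<open>Suppose a simple \<open>S\<close> is not contained in \<open>L + C\<close>; then it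
  meets \<open>L + C\<close> only in zero. If \<open>c + s\<close> lies in \<open>L\<close>, then
  \<open>s = (c + s) - c\<close> lies in \<open>S \<inter> (L + C)\<close>, so \<open>s\<close> is
  zero and \<open>c\<close> lies in \<open>C \<inter> L\<close>. Thus \<open>C + S\<close> still
  meets \<open>L\<close> trivially, and maximality puts \<open>S\<close> inside \<open>C\<close>, a
  contradiction.\<close>

lemma Soc_subset_add_maximal_disjoint:
  assumes L: "submodule L R M" and C: "submodule C R M" and disj: "C \<inter> L = {\<zero>\<^bsub>M\<^esub>}"
    and max: "\<And>D. submodule D R M \<Longrightarrow> D \<inter> L = {\<zero>\<^bsub>M\<^esub>} \<Longrightarrow> C \<subseteq> D \<Longrightarrow> D = C"
  shows "Soc R M \<subseteq> {x \<oplus>\<^bsub>M\<^esub> y | x y. x \<in> L \<and> y \<in> C}" (is "_ \<subseteq> ?LC")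
proof (rule Soc_least)
  show LC: "submodule ?LC R M" using submodule_add[OF L C] .
  note Lc = L[unfolded submodule_iff] and Cc = C[unfolded submodule_iff]
  fix S assume S: "submodule S R M" and simple: "simple_module R (M\<lparr>carrier := S\<rparr>)"
  note Sc = S[unfolded submodule_iff]
  show "S \<subseteq> ?LC"
  proof (rule ccontr)
    assume not: "\<not> S \<subseteq> ?LC"
    have "submodule (S \<inter> ?LC) R (M\<lparr>carrier := S\<rparr>)"
      using submodule_of_submodule_iff[OF S] submodule_Int[OF S LC] by blast
    with simple not have zero: "S \<inter> ?LC = {\<zero>\<^bsub>M\<^esub>}"
      unfolding simple_module_def by auto
    let ?D = "{x \<oplus>\<^bsub>M\<^esub> y | x y. x \<in> C \<and> y \<in> S}"
    have D: "submodule ?D R M" using submodule_add[OF C S] .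
    have "w = \<zero>\<^bsub>M\<^esub>" if w: "w \<in> ?D" "w \<in> L" for w
    proof -
      from w obtain c s where cs: "w = c \<oplus>\<^bsub>M\<^esub> s" "c \<in> C" "s \<in> S" by blast
      have carr: "c \<in> carrier M" "s \<in> carrier M" using cs Cc Sc by auto
      have "w \<oplus>\<^bsub>M\<^esub> (\<ominus>\<^bsub>M\<^esub> c) = s"
        using cs carr M.add_minus_cancel[of s c] by (simp add: M.a_comm M.minus_eq)
      moreover have "w \<oplus>\<^bsub>M\<^esub> (\<ominus>\<^bsub>M\<^esub> c) \<in> ?LC" using w(2) cs(2) submoduleE(3)[OF C] by blast
      ultimately have "s = \<zero>\<^bsub>M\<^esub>" using zero cs(3) by blast
      then have "w \<in> C" using cs carr by simp
      then show ?thesis using w(2) disj by blast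
    qed
    moreover have "\<zero>\<^bsub>M\<^esub> \<in> ?D" "\<zero>\<^bsub>M\<^esub> \<in> L" using D Lc by (simp_all add: submodule_iff)
    ultimately have "?D \<inter> L = {\<zero>\<^bsub>M\<^esub>}" by blast
    moreover have "C \<subseteq> ?D"
    proof
      fix c assume c: "c \<in> C"
      then have "c = c \<oplus>\<^bsub>M\<^esub> \<zero>\<^bsub>M\<^esub>" using Cc by auto
      then show "c \<in> ?D" using c Sc by blast
    qed
    \<comment> \<open>Since \<open>S\<close> is contained in \<open>?D = C\<close>, it is contained
      in \<open>L + C\<close> after all.\<close>
    ultimately have eq: "?D = C" using max D by blast
    have "S \<subseteq> ?LC"
    proof
      fix s assume s: "s \<in> S"
      then have e: "s = \<zero>\<^bsub>M\<^esub> \<oplus>\<^bsub>M\<^esub> s" using Sc by auto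
      then have "s \<in> ?D" using s Cc by blast
      then show "s \<in> ?LC" using e eq Lc by blast
    qed
    then show False using not by blast
  qed
qed

text \<open>As \<open>L\<close> and \<open>C\<close> meet only in zero, their sum is direct; the
  extension is \<open>f\<close> composed with the projection onto \<open>L\<close> along
  \<open>C\<close>.\<close>

lemma extend_to_direct_sum:
  assumes L: "submodule L R M" and C: "submodule C R M"
    and disj: "C \<inter> L = {\<zero>\<^bsub>M\<^esub>}" and f: "f \<in> mod_hom R (M\<lparr>carrier := L\<rparr>) P"
  shows "\<exists>h\<in>mod_hom R (M\<lparr>carrier := {x \<oplus>\<^bsub>M\<^esub> y | x y. x \<in> L \<and> y \<in> C}\<rparr>) P. \<forall>x\<in>L. h x = f x"
proof -
  note Lc = L[unfolded submodule_iff] and Cc = C[unfolded submodule_iff]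
  have uniq: "x = x'" if "x \<in> L" "y \<in> C" "x' \<in> L" "y' \<in> C" "x \<oplus>\<^bsub>M\<^esub> y = x' \<oplus>\<^bsub>M\<^esub> y'" for x y x' y'
  proof -
    have carr: "x \<in> carrier M" "y \<in> carrier M" "x' \<in> carrier M" "y' \<in> carrier M"
      using that Lc Cc by auto
    \<comment> \<open>Equal sums give \<open>x - x' = y' - y\<close>, an element of both
      \<open>L\<close> and \<open>C\<close>, hence zero.\<close>
    have "x \<ominus>\<^bsub>M\<^esub> x' = (x \<oplus>\<^bsub>M\<^esub> y) \<ominus>\<^bsub>M\<^esub> (x' \<oplus>\<^bsub>M\<^esub> y)"
      using carr by (simp add: M.add_minus_add M.minus_self)
    also have "\<dots> = y' \<ominus>\<^bsub>M\<^esub> y"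
      unfolding that(5) using carr by (simp add: M.add_minus_add M.minus_self)
    finally have "x \<ominus>\<^bsub>M\<^esub> x' \<in> C \<inter> L"
      using that submodule_minus[OF L, of x x'] submodule_minus[OF C, of y' y] by simp
    then show ?thesis using disj carr M.minus_eq_zeroD by blast
  qed
  \<comment> \<open>The description picks the \<open>L\<close>-component of \<open>z\<close>, which
    \<open>uniq\<close> makes well defined on \<open>L + C\<close>.\<close>
  define h where "h z = f (THE x. x \<in> L \<and> (\<exists>y\<in>C. z = x \<oplus>\<^bsub>M\<^esub> y))" for z
  have h: "h (x \<oplus>\<^bsub>M\<^esub> y) = f x" if "x \<in> L" "y \<in> C" for x y
  proof -
    have "(THE x'. x' \<in> L \<and> (\<exists>y'\<in>C. x \<oplus>\<^bsub>M\<^esub> y = x' \<oplus>\<^bsub>M\<^esub> y')) = x"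
      using that uniq by (intro the_equality) blast+
    then show ?thesis by (simp add: h_def)
  qed
  have fD: "\<And>x. x \<in> L \<Longrightarrow> f x \<in> carrier P"
    "\<And>x y. x \<in> L \<Longrightarrow> y \<in> L \<Longrightarrow> f (x \<oplus>\<^bsub>M\<^esub> y) = f x \<oplus>\<^bsub>P\<^esub> f y"
    "\<And>r x. r \<in> carrier R \<Longrightarrow> x \<in> L \<Longrightarrow> f (r \<odot>\<^bsub>M\<^esub> x) = r \<odot>\<^bsub>P\<^esub> f x"
    using mod_homD[OF f] by simp_all
  have "h \<in> mod_hom R (M\<lparr>carrier := {x \<oplus>\<^bsub>M\<^esub> y | x y. x \<in> L \<and> y \<in> C}\<rparr>) P"
  proof -
    have "h ((x \<oplus>\<^bsub>M\<^esub> y) \<oplus>\<^bsub>M\<^esub> (x' \<oplus>\<^bsub>M\<^esub> y')) = h (x \<oplus>\<^bsub>M\<^esub> y) \<oplus>\<^bsub>P\<^esub> h (x' \<oplus>\<^bsub>M\<^esub> y')"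
      if a: "x \<in> L" "y \<in> C" "x' \<in> L" "y' \<in> C" for x y x' y'
    proof -
      have carr: "x \<in> carrier M" "y \<in> carrier M" "x' \<in> carrier M" "y' \<in> carrier M"
        using a Lc Cc by auto
      have "(x \<oplus>\<^bsub>M\<^esub> y) \<oplus>\<^bsub>M\<^esub> (x' \<oplus>\<^bsub>M\<^esub> y') = (x \<oplus>\<^bsub>M\<^esub> x') \<oplus>\<^bsub>M\<^esub> (y \<oplus>\<^bsub>M\<^esub> y')"
        using carr by (simp add: M.a_ac)
      then show ?thesis using a h fD(2) Lc Cc by simp
    qed
    moreover have "h (r \<odot>\<^bsub>M\<^esub> (x \<oplus>\<^bsub>M\<^esub> y)) = r \<odot>\<^bsub>P\<^esub> h (x \<oplus>\<^bsub>M\<^esub> y)"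
      if a: "r \<in> carrier R" "x \<in> L" "y \<in> C" for r x y
    proof -
      have "x \<in> carrier M" "y \<in> carrier M" using a Lc Cc by auto
      then have "r \<odot>\<^bsub>M\<^esub> (x \<oplus>\<^bsub>M\<^esub> y) = r \<odot>\<^bsub>M\<^esub> x \<oplus>\<^bsub>M\<^esub> r \<odot>\<^bsub>M\<^esub> y"
        using a smult_r_distr by simp
      then show ?thesis using a h fD(3) Lc Cc by simp
    qed
    ultimately show ?thesis using h fD(1) by (auto simp: mod_hom_def)
  qed
  moreover have "h x = f x" if x: "x \<in> L" for x
  proof -
    have "x \<oplus>\<^bsub>M\<^esub> \<zero>\<^bsub>M\<^esub> = x" using x Lc by auto
    then show ?thesis using h[OF x, of "\<zero>\<^bsub>M\<^esub>"] Cc by simp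
  qed
  ultimately show ?thesis by blast
qed

end

section \<open>The relative implications\<close>

lemma rel_injective_imp_Red_rel_injective:
  "rel_injective R N M \<Longrightarrow> Red_rel_injective R N M"
  by (simp add: rel_injective_def Red_rel_injective_def)

lemma Red_rel_injective_imp_Soc_rel_injective:
  assumes "module R N" and "Red_rel_injective R N M"
  shows "Soc_rel_injective R N M"
  using assms module.Soc_submodule[OF assms(1)] module.Soc_semi_reduced[OF assms(1)]
  by (simp add: Red_rel_injective_def Soc_rel_injective_def)

lemma Soc_rel_injective_imp_min_rel_injective:
  assumes "module R N" and soc: "Soc_rel_injective R N M"
  shows "min_rel_injective R N M"
  unfolding min_rel_injective_def homs_extend_def
proof (intro allI impI ballI)
  fix L f
  assume L: "submodule L R N \<and> simple_module R (N\<lparr>carrier := L\<rparr>)"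
    and f: "f \<in> mod_hom R (N\<lparr>carrier := L\<rparr>) M"
  then obtain C where C: "submodule C R N" "C \<inter> L = {\<zero>\<^bsub>N\<^esub>}"
    and max: "\<And>D. submodule D R N \<Longrightarrow> D \<inter> L = {\<zero>\<^bsub>N\<^esub>} \<Longrightarrow> C \<subseteq> D \<Longrightarrow> D = C"
    using module.maximal_disjoint_submodule[OF assms(1)] by metis
  let ?LC = "{x \<oplus>\<^bsub>N\<^esub> y | x y. x \<in> L \<and> y \<in> C}"
  obtain h where h: "h \<in> mod_hom R (N\<lparr>carrier := ?LC\<rparr>) M" and hf: "\<forall>x\<in>L. h x = f x"
    using module.extend_to_direct_sum[OF assms(1) _ C f] L by blast
  have "Soc R N \<subseteq> ?LC"
    using module.Soc_subset_add_maximal_disjoint[OF assms(1) _ C max] L by blast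
  \<comment> \<open>Only the restriction of \<open>h\<close> to the socle is extended to
    \<open>N\<close>. The result may differ from \<open>h\<close> on the rest of
    \<open>L + C\<close>, but it agrees with \<open>f\<close> on \<open>L\<close> because the simple
    submodule \<open>L\<close> lies in the socle.\<close>
  then have "h \<in> mod_hom R (N\<lparr>carrier := Soc R N\<rparr>) M"
    using mod_hom_restrict[OF h, of "Soc R N" "carrier M"] mod_homD(1)[OF h] by auto
  then obtain g where "g \<in> mod_hom R N M" "\<forall>x\<in>Soc R N. g x = h x"
    using soc unfolding Soc_rel_injective_def homs_extend_def by blast
  then show "\<exists>g\<in>mod_hom R N M. \<forall>x\<in>L. g x = f x"
    using hf module.simple_subset_Soc[OF assms(1)] L by (metis subsetD)
qed

text \<open>The image of a simple module is zero or simple. A zero map extends by zero, and in the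
  other case simple-injectivity applies directly, with the same test module
  \<open>N\<close>.\<close>

lemma simple_rel_injective_imp_min_rel_injective:
  assumes "module R N" and "module R M" and simp_inj: "simple_rel_injective R N M"
  shows "min_rel_injective R N M"
  unfolding min_rel_injective_def homs_extend_def
proof (intro allI impI ballI)
  interpret M: module R M by fact
  fix L f
  assume "submodule L R N \<and> simple_module R (N\<lparr>carrier := L\<rparr>)"
    and f: "f \<in> mod_hom R (N\<lparr>carrier := L\<rparr>) M"
  then have L: "submodule L R N" and simple: "simple_module R (N\<lparr>carrier := L\<rparr>)" by auto
  have modL: "module R (N\<lparr>carrier := L\<rparr>)"
    using submodule.submodule_is_module[OF L assms(1)] .
  show "\<exists>g\<in>mod_hom R N M. \<forall>x\<in>L. g x = f x"
  proof (cases "f ` L = {\<zero>\<^bsub>M\<^esub>}")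
    case True
    have "(\<lambda>_. \<zero>\<^bsub>M\<^esub>) \<in> mod_hom R N M" by (simp add: mod_hom_def)
    moreover have "\<forall>x\<in>L. \<zero>\<^bsub>M\<^esub> = f x" using True by (metis imageI singletonD)
    ultimately show ?thesis by (intro bexI[of _ "\<lambda>_. \<zero>\<^bsub>M\<^esub>"]) assumption+
  next
    case False
    have image: "submodule (f ` L) R M"
      using module_homomorphism.range_submodule[OF module_homomorphismI[OF modL assms(2) f]] by simp
    have f': "f \<in> mod_hom R (N\<lparr>carrier := L\<rparr>) (M\<lparr>carrier := f ` L\<rparr>)"
      using mod_hom_restrict[OF f, of L] by simp
    have "simple_module R (M\<lparr>carrier := f ` L\<rparr>)"
      using module_homomorphism.simple_image[OF module_homomorphismI[OF modL
            submodule.submodule_is_module[OF image assms(2)] f'] _ simple] False by simp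
    then show ?thesis using simp_inj L f unfolding simple_rel_injective_def by blast
  qed
qed

text \<open>The domain \<open>L\<close> need not be simple, so min-injectivity is applied to the
  quotient of \<open>N\<close> by the kernel of the given map instead of to \<open>N\<close>. Hence
  the assumption ranges over all test modules; the quotient is one of them because it is built on
  the carrier type of \<open>N\<close>.\<close>

lemma simple_rel_injective_if_min_rel_injective:
  fixes N :: "('r, 'n, 'p) module_scheme"
  assumes "module R N" and "module R M"
    and min_inj: "\<And>Q :: ('r, 'n) module. module R Q \<Longrightarrow> min_rel_injective R Q M"
  shows "simple_rel_injective R N M"
  unfolding simple_rel_injective_def
proof (intro allI impI ballI)
  fix L \<theta>
  assume L: "submodule L R N" and \<theta>: "\<theta> \<in> mod_hom R (N\<lparr>carrier := L\<rparr>) M"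
    and simple: "simple_module R (M\<lparr>carrier := \<theta> ` L\<rparr>)"
  have L_sub: "L \<subseteq> carrier N" using module.submoduleE(1)[OF assms(1) L] .
  have modL: "module R (N\<lparr>carrier := L\<rparr>)"
    using submodule.submodule_is_module[OF L assms(1)] .
  note \<theta>_hom = module_homomorphismI[OF modL assms(2) \<theta>]
  have image: "submodule (\<theta> ` L) R M"
    using module_homomorphism.range_submodule[OF \<theta>_hom] by simp
  have mod_im: "module R (M\<lparr>carrier := \<theta> ` L\<rparr>)"
    using submodule.submodule_is_module[OF image assms(2)] .
  have \<theta>': "\<theta> \<in> mod_hom R (N\<lparr>carrier := L\<rparr>) (M\<lparr>carrier := \<theta> ` L\<rparr>)"
    using mod_hom_restrict[OF \<theta>, of L] by simp
  define K where "K = {x \<in> L. \<theta> x = \<zero>\<^bsub>M\<^esub>}"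
  have "submodule {\<zero>\<^bsub>M\<^esub>} R M"
    using module.smult_r_null[OF assms(2)] abelian_groupE[OF module.axioms(2)[OF assms(2)]]
    by (simp add: module.submodule_iff[OF assms(2)])
  \<comment> \<open>The kernel arises as a submodule of \<open>L\<close>, but the quotient is taken
    of the whole of \<open>N\<close>, so it has to be seen as a submodule of
    \<open>N\<close>.\<close>
  from module_homomorphism.vimage_submodule[OF \<theta>_hom this] have "submodule K R N"
    using module.submodule_of_submodule_iff[OF assms(1) L] by (simp add: K_def)
  then obtain Q :: "('r, 'n) module" and p where modQ: "module R Q" and p: "p \<in> mod_hom R N Q"
    and kerp: "\<And>x. x \<in> carrier N \<Longrightarrow> p x = \<zero>\<^bsub>Q\<^esub> \<longleftrightarrow> x \<in> K"
    using module.quotient_module_exists[OF assms(1)] by metis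
  have ker: "p x = \<zero>\<^bsub>Q\<^esub> \<longleftrightarrow> \<theta> x = \<zero>\<^bsub>M\<^esub>" if "x \<in> L" for x
    using that kerp L_sub by (auto simp: K_def)
  have pL: "submodule (p ` L) R Q"
    using module_homomorphism.image_submodule[OF module_homomorphismI[OF assms(1) modQ p] L] .
  have mod_pL: "module R (Q\<lparr>carrier := p ` L\<rparr>)"
    using submodule.submodule_is_module[OF pL modQ] .
  have p': "p \<in> mod_hom R (N\<lparr>carrier := L\<rparr>) (Q\<lparr>carrier := p ` L\<rparr>)"
    using mod_hom_restrict[OF p L_sub] by simp
  obtain f where f: "f \<in> mod_hom R (Q\<lparr>carrier := p ` L\<rparr>) M" and fp: "\<forall>x\<in>L. f (p x) = \<theta> x"
    using module_homomorphism.factor[OF module_homomorphismI[OF modL mod_pL p'] _ \<theta>_hom] ker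
    by auto
  obtain h where h: "h \<in> mod_hom R (M\<lparr>carrier := \<theta> ` L\<rparr>) (Q\<lparr>carrier := p ` L\<rparr>)"
    and hp: "\<forall>x\<in>L. h (\<theta> x) = p x"
    using module_homomorphism.factor[OF module_homomorphismI[OF modL mod_im \<theta>'] _
        module_homomorphismI[OF modL mod_pL p']] ker by auto
  \<comment> \<open>Nonzeroness is the remaining requirement of \<open>simple_image\<close>: if
    \<open>p\<close> vanished on \<open>L\<close>, so would \<theta>, and its image would not be
    simple.\<close>
  have "p ` L \<noteq> {\<zero>\<^bsub>Q\<^esub>}"
  proof
    assume "p ` L = {\<zero>\<^bsub>Q\<^esub>}"
    then have "\<theta> x = \<zero>\<^bsub>M\<^esub>" if "x \<in> L" for x using that ker by blast
    then have "\<theta> ` L = (\<lambda>_. \<zero>\<^bsub>M\<^esub>) ` L" by (intro image_cong refl)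
    then have "\<theta> ` L = {\<zero>\<^bsub>M\<^esub>}"
      using module.submoduleE(2)[OF assms(1) L] by (simp only: image_constant_conv if_False)
    then show False using simple by (simp add: simple_module_def)
  qed
  moreover have "h ` \<theta> ` L = p ` L" using hp by (simp add: image_image)
  ultimately have "simple_module R (Q\<lparr>carrier := p ` L\<rparr>)"

    using module_homomorphism.simple_image[OF module_homomorphismI[OF mod_im mod_pL h]] simple
    by simp
  then obtain g where g: "g \<in> mod_hom R Q M" "\<forall>z\<in>p ` L. g z = f z"
    using min_inj[OF modQ] pL f unfolding min_rel_injective_def homs_extend_def by blast
  \<comment> \<open>Pulling the extension \<open>g\<close> back along \<open>p\<close> gives
    \<open>g (p x) = f (p x) = \<theta> x\<close> on \<open>L\<close>.\<close>
  then show "\<exists>g\<in>mod_hom R N M. \<forall>x\<in>L. g x = \<theta> x"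
    using mod_hom_comp[OF p g(1)] fp by (intro bexI[of _ "g \<circ> p"]) auto
qed

theorem proposition6:
  fixes R :: "('r, 'x) ring_scheme"
    and N :: "('r, 'n) module"
    and M :: "('r, 'm, 'q) module_scheme"
  assumes "cring R" and "module R N" and "module R M"
  shows
    "((injective_module TYPE('n) R M \<longrightarrow> rel_injective R N M) \<and>
      (rel_injective R N M \<longrightarrow> Red_rel_injective R N M) \<and>
      (Red_rel_injective R N M \<longrightarrow> Soc_rel_injective R N M) \<and>
      (Soc_rel_injective R N M \<longrightarrow> min_rel_injective R N M)) \<and>
     ((injective_module TYPE('n) R M \<longrightarrow> strongly_Red_injective TYPE('n) R M) \<and>
      (strongly_Red_injective TYPE('n) R M \<longrightarrow> strongly_Soc_injective TYPE('n) R M) \<and>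
      (strongly_Soc_injective TYPE('n) R M \<longrightarrow> strongly_min_injective TYPE('n) R M) \<and>
      (strongly_min_injective TYPE('n) R M \<longleftrightarrow> strongly_simple_injective TYPE('n) R M))"
proof -
  \<comment> \<open>The relative implications are restated for an arbitrary \<open>N\<close> over
    the type \<open>'n\<close>: the fixed \<open>N\<close> serves the first chain, while the
    absolute notions need every test module.\<close>
  have Red: "rel_injective R N M \<Longrightarrow> Red_rel_injective R N M"
    and Soc: "module R N \<Longrightarrow> Red_rel_injective R N M \<Longrightarrow> Soc_rel_injective R N M"
    and min: "module R N \<Longrightarrow> Soc_rel_injective R N M \<Longrightarrow> min_rel_injective R N M"
    for N :: "('r, 'n) module"
    using rel_injective_imp_Red_rel_injective Red_rel_injective_imp_Soc_rel_injective
      Soc_rel_injective_imp_min_rel_injective by blast+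
  \<comment> \<open>From right to left the argument stays with one test module at a time; from left
    to right it passes from a test module to its quotients.\<close>
  have "strongly_min_injective TYPE('n) R M \<longleftrightarrow> strongly_simple_injective TYPE('n) R M"
    unfolding strongly_min_injective_def strongly_simple_injective_def
    using simple_rel_injective_imp_min_rel_injective[OF _ assms(3)]
      simple_rel_injective_if_min_rel_injective[OF _ assms(3)] by blast
  then show ?thesis
    using Red Soc min assms(2)
    by (simp add: injective_module_def strongly_Red_injective_def strongly_Soc_injective_def
        strongly_min_injective_def)
qed

thm_deps proposition6

end
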